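(* Let $\mathcal I\subseteq\mathcal P(\mathbb R^2)$ be a proper, translation-invariant $\sigma$-ideal containing singletons, having a Borel base, and such that every unit circle belongs to $\mathcal I$. Then there exists a completely $\mathcal I$-nonmeasurable set $B\subseteq\mathbb R^2$ which is not a $2$-I-covering.
   Context: A unit circle is $\{y\in\mathbb R^2:\|y-x\|=1\}$ for some $x$. Borel base: every set in $\mathcal I$ is contained in a Borel set in $\mathcal I$. A set $N$ is completely $\mathcal I$-nonmeasurable if for every Borel $A\notin\mathcal I$ both $A\cap N\notin\mathcal I$ and $A\setminus N\notin\mathcal I$. A set $A\subseteq\mathbb R^2$ is a $2$-I-covering if for every $C\subseteq\mathbb R^2$ with $|C|=2$ there is an isometry $\phi$ of the Euclidean plane with $\phi[C]\subseteq A$. *)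

theory Defs
  imports "HOL-Analysis.Analysis"
begin

type_synonym plane = "real ^ 2"

definition sigma_ideal :: "plane set set \<Rightarrow> bool" where
  "sigma_ideal I \<longleftrightarrow> {} \<in> I
     \<and> (\<forall>A B. A \<in> I \<longrightarrow> B \<subseteq> A \<longrightarrow> B \<in> I)
     \<and> (\<forall>F :: nat \<Rightarrow> plane set. (\<forall>n. F n \<in> I) \<longrightarrow> (\<Union>n. F n) \<in> I)"

definition proper_ideal :: "plane set set \<Rightarrow> bool" where
  "proper_ideal I \<longleftrightarrow> UNIV \<notin> I"

definition translation_invariant :: "plane set set \<Rightarrow> bool" where
  "translation_invariant I \<longleftrightarrow> (\<forall>A x. A \<in> I \<longrightarrow> (\<lambda>y. x + y) ` A \<in> I)"

definition has_borel_base :: "plane set set \<Rightarrow> bool" where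
  "has_borel_base I \<longleftrightarrow> (\<forall>A \<in> I. \<exists>B \<in> sets borel. A \<subseteq> B \<and> B \<in> I)"

definition completely_nonmeasurable :: "plane set set \<Rightarrow> plane set \<Rightarrow> bool" where
  "completely_nonmeasurable I N \<longleftrightarrow>
     (\<forall>A \<in> sets borel. A \<notin> I \<longrightarrow> A \<inter> N \<notin> I \<and> A - N \<notin> I)"

definition plane_isometry :: "(plane \<Rightarrow> plane) \<Rightarrow> bool" where
  "plane_isometry \<phi> \<longleftrightarrow> surj \<phi> \<and> (\<forall>x y. dist (\<phi> x) (\<phi> y) = dist x y)"

definition two_I_covering :: "plane set \<Rightarrow> bool" where
  "two_I_covering A \<longleftrightarrow>
     (\<forall>C :: plane set. card C = 2 \<longrightarrow> (\<exists>\<phi>. plane_isometry \<phi> \<and> \<phi> ` C \<subseteq> A))"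

end

(*
  A set B without two points at distance 1 is not a 2-I-covering, and if it meets every
  I-positive Borel set it is already completely nonmeasurable: a positive Borel subset of B
  would have a positive unit translate disjoint from B.

  Such a B is built by transfinite recursion over all Borel sets A that are not covered by
  countably many unit circles, choosing in each a point off the unit circles around the fewer
  than continuum many points chosen before. This is possible without any hypothesis on
  cardinals because A, being the projection of a closed subset of a Polish space, contains
  continuum many points of which no three lie on a common unit circle. They are the branches
  of a Cantor scheme: two points lie on only finitely many unit circles, so a third point in
  general position can be found in any set not covered by countably many of them, and being in
  general position is an open condition.
*)
theory Submission
  imports Defs
begin

subsection \<open>Unit circles\<close>

text \<open>Only circles of radius one count, and coinciding points are allowed, so that the
  relation is closed.\<close>

definition cocircular :: "plane \<Rightarrow> plane \<Rightarrow> plane \<Rightarrow> bool" where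
  "cocircular x y z \<longleftrightarrow> (\<exists>c. {x, y, z} \<subseteq> sphere c 1)"

text \<open>The difference of the two circle equations fixes the component of \<open>c - x\<close>
  along \<open>y - x\<close>, and the length of \<open>c - x\<close> then fixes the square of the
  other component. This leaves at most two centres.\<close>

lemma finite_unit_circles_through_two_points:
  fixes x y :: plane
  assumes "x \<noteq> y"
  shows "finite {c. x \<in> sphere c 1 \<and> y \<in> sphere c 1}"
proof -
  define d1 d2 where d: "d1 = y $ 1 - x $ 1" "d2 = y $ 2 - x $ 2"
  \<comment> \<open>\<open>h c\<close> is the cross product of \<open>c - x\<close> and
    \<open>y - x\<close>; \<open>w\<close> is the value that its square must take when
    \<open>c\<close> is a centre.\<close>
  define w where "w = d1\<^sup>2 + d2\<^sup>2 - ((d1\<^sup>2 + d2\<^sup>2) / 2)\<^sup>2"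
  define h :: "plane \<Rightarrow> real" where "h c = (c $ 1 - x $ 1) * d2 - (c $ 2 - x $ 2) * d1" for c
  let ?S = "{c. x \<in> sphere c 1 \<and> y \<in> sphere c 1}"
  have d0: "d1\<^sup>2 + d2\<^sup>2 \<noteq> 0"
    using assms by (auto simp: d vec_eq_iff forall_2 sum_power2_eq_zero_iff)
  have S: "(c $ 1 - x $ 1)\<^sup>2 + (c $ 2 - x $ 2)\<^sup>2 = 1"
    "(c $ 1 - x $ 1) * d1 + (c $ 2 - x $ 2) * d2 = (d1\<^sup>2 + d2\<^sup>2) / 2" if "c \<in> ?S" for c
  proof -
    have *: "(c $ 1 - p $ 1)\<^sup>2 + (c $ 2 - p $ 2)\<^sup>2 = 1" if "dist c p = 1" for p
      using that by (simp add: dist_norm norm_eq_1 inner_vec_def sum_2 power2_eq_square)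
    show 1: "(c $ 1 - x $ 1)\<^sup>2 + (c $ 2 - x $ 2)\<^sup>2 = 1" using that * by auto
    have "(c $ 1 - y $ 1)\<^sup>2 + (c $ 2 - y $ 2)\<^sup>2 = 1" using that * by auto
    with 1 show "(c $ 1 - x $ 1) * d1 + (c $ 2 - x $ 2) * d2 = (d1\<^sup>2 + d2\<^sup>2) / 2"
      unfolding d by (simp add: power2_eq_square field_simps)
  qed
  have "h ` ?S \<subseteq> {sqrt w, - sqrt w}"
  proof
    fix r assume "r \<in> h ` ?S"
    then obtain c where c: "c \<in> ?S" and r: "r = h c" by auto
    \<comment> \<open>Lagrange's identity: the squares of the cross product and of the inner product
      add up to the product of the squared lengths.\<close>
    have "r\<^sup>2 + ((c $ 1 - x $ 1) * d1 + (c $ 2 - x $ 2) * d2)\<^sup>2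
        = ((c $ 1 - x $ 1)\<^sup>2 + (c $ 2 - x $ 2)\<^sup>2) * (d1\<^sup>2 + d2\<^sup>2)"
      unfolding r h_def by algebra
    then have "r\<^sup>2 = w" unfolding S[OF c] w_def by simp
    then have "\<bar>r\<bar> = sqrt w" by (metis real_sqrt_abs)
    then show "r \<in> {sqrt w, - sqrt w}" by auto
  qed
  then have "finite (h ` ?S)" by (rule finite_subset) simp
  moreover have "inj_on h ?S"
  proof (rule inj_onI)
    fix a b assume ab: "a \<in> ?S" "b \<in> ?S" "h a = h b"
    \<comment> \<open>\<open>a - b\<close> is both orthogonal and parallel to the nonzero vector
      \<open>(d1, d2)\<close>, hence zero.\<close>
    have e: "(a $ 1 - b $ 1) * d1 + (a $ 2 - b $ 2) * d2 = 0"
      using S(2)[OF ab(1)] S(2)[OF ab(2)] by (simp add: algebra_simps)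
    have f: "(a $ 1 - b $ 1) * d2 - (a $ 2 - b $ 2) * d1 = 0"
      using ab(3) by (simp add: h_def algebra_simps)
    have "(a $ 1 - b $ 1) * (d1\<^sup>2 + d2\<^sup>2) = 0" "(a $ 2 - b $ 2) * (d1\<^sup>2 + d2\<^sup>2) = 0"
      using e f by algebra+
    with d0 show "a = b" by (auto simp: vec_eq_iff forall_2)
  qed
  ultimately show ?thesis by (rule finite_imageD)
qed

text \<open>The cocircular triples form the sum of the closed diagonal, which carries the common
  centre, and a compact product of three unit circles; a closed plus a compact set is
  closed.\<close>

lemma closed_cocircular: "closed {(x, y, z). cocircular x y z}"
proof -
  let ?S = "sphere (0 :: plane) 1"
  let ?D = "{p :: plane \<times> plane \<times> plane. fst p = fst (snd p) \<and> fst (snd p) = snd (snd p)}"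
  have "closed ?D"
    by (intro closed_Collect_conj closed_Collect_eq continuous_intros)
  moreover have "compact (?S \<times> ?S \<times> ?S)"
    by (intro compact_Times) auto
  ultimately have "closed (\<Union>p\<in>?D. \<Union>q\<in>?S \<times> ?S \<times> ?S. {p + q})"
    by (rule closed_compact_sums)
  also have "\<dots> = {(x, y, z). cocircular x y z}"
  proof (intro equalityI subsetI)
    fix t assume "t \<in> {(x, y, z). cocircular x y z}"
    then obtain x y z c where t: "t = (x, y, z)" and c: "{x, y, z} \<subseteq> sphere c 1"
      by (auto simp: cocircular_def)
    have "t = (c, c, c) + (x - c, y - c, z - c)" using t by simp
    moreover have "(x - c, y - c, z - c) \<in> ?S \<times> ?S \<times> ?S"
      using c by (auto simp: dist_norm norm_minus_commute)
    moreover have "(c, c, c) \<in> ?D" by simp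
    ultimately show "t \<in> (\<Union>p\<in>?D. \<Union>q\<in>?S \<times> ?S \<times> ?S. {p + q})"
      by blast
  next
    fix t assume "t \<in> (\<Union>p\<in>?D. \<Union>q\<in>?S \<times> ?S \<times> ?S. {p + q})"
    then obtain c u v w where "t = (c + u, c + v, c + w)" "u \<in> ?S" "v \<in> ?S" "w \<in> ?S" by auto
    then show "t \<in> {(x, y, z). cocircular x y z}"
      by (auto simp: cocircular_def dist_norm intro!: exI[of _ c])
  qed
  finally show ?thesis .
qed

text \<open>Stated for indexed families rather than sets, so that the points can move while the
  indices stay fixed.\<close>

definition general_position_on :: "'i set \<Rightarrow> ('i \<Rightarrow> plane) \<Rightarrow> bool" where
  "general_position_on S q \<longleftrightarrow> inj_on q S \<and>
     (\<forall>s\<in>S. \<forall>t\<in>S. \<forall>u\<in>S. s \<noteq> t \<longrightarrow> t \<noteq> u \<longrightarrow> s \<noteq> u \<longrightarrow> \<not> cocircular (q s) (q t) (q u))"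

text \<open>At most two indices qualify, since three of them would give a cocircular triple.\<close>

lemma finite_general_position_on_sphere:
  assumes "general_position_on S q"
  shows "finite {s \<in> S. q s \<in> sphere c 1}"
proof (rule ccontr)
  assume "infinite {s \<in> S. q s \<in> sphere c 1}"
  then obtain T where "T \<subseteq> {s \<in> S. q s \<in> sphere c 1}" "card T = 3"
    by (meson infinite_arbitrarily_large)
  then obtain s t u where "{s, t, u} \<subseteq> {s \<in> S. q s \<in> sphere c 1}" "s \<noteq> t" "t \<noteq> u" "s \<noteq> u"
    by (auto simp: card_3_iff)
  with assms show False
    unfolding general_position_on_def cocircular_def by blast
qed

text \<open>Distinctness and failure of cocircularity are open conditions, and only finitely many
  pairs and triples matter. Arguing with all sufficiently small \<open>e\<close> in the filter
  \<open>at_right 0\<close> replaces taking minima of radii.\<close>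

lemma general_position_on_stable:
  assumes "finite S" and gp: "general_position_on S q"
  shows "\<exists>e>0. \<forall>q'. (\<forall>s\<in>S. dist (q' s) (q s) < e) \<longrightarrow> general_position_on S q'"
proof -
  have pair: "\<forall>\<^sub>F e in at_right (0 :: real). s \<noteq> t \<longrightarrow>
      (\<forall>x y. dist x (q s) < e \<longrightarrow> dist y (q t) < e \<longrightarrow> x \<noteq> y)"
    if "s \<in> S" "t \<in> S" for s t
  proof (cases "s = t")
    case False
    then have "0 < dist (q s) (q t) / 2"
      using gp that by (auto simp: general_position_on_def inj_on_def)
    from eventually_at_right_less[of 0] eventually_at_right_real[OF this]
    show ?thesis
    proof eventually_elim
      case (elim e)
      show ?case
      proof (intro impI allI notI)
        fix x y assume "dist x (q s) < e" "dist y (q t) < e" "x = y"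
        then have "dist (q s) (q t) < e + e"
          using dist_triangle3[of "q s" "q t" x] by simp
        with elim show False by simp
      qed
    qed
  qed simp
  have triple: "\<forall>\<^sub>F e in at_right (0 :: real). s \<noteq> t \<longrightarrow> t \<noteq> u \<longrightarrow> s \<noteq> u \<longrightarrow>
      (\<forall>x y z. dist x (q s) < e \<longrightarrow> dist y (q t) < e \<longrightarrow> dist z (q u) < e \<longrightarrow> \<not> cocircular x y z)"
    if "s \<in> S" "t \<in> S" "u \<in> S" for s t u
  proof (cases "s \<noteq> t \<and> t \<noteq> u \<and> s \<noteq> u")
    case True
    have "open (- {(x, y, z). cocircular x y z})"
      using closed_cocircular by (rule open_Compl)
    moreover have "(q s, q t, q u) \<in> - {(x, y, z). cocircular x y z}"
      using gp True that by (auto simp: general_position_on_def)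
    ultimately obtain A W where AW: "open A" "open W" "(q s, q t, q u) \<in> A \<times> W"
      "A \<times> W \<subseteq> - {(x, y, z). cocircular x y z}"
      by (rule open_prod_elim)
    from AW have "(q t, q u) \<in> W" by simp
    with AW(2) obtain B C where BC: "open B" "open C" "(q t, q u) \<in> B \<times> C" "B \<times> C \<subseteq> W"
      by (rule open_prod_elim)
    have ABC: "open A" "open B" "open C" "q s \<in> A" "q t \<in> B" "q u \<in> C"
      "A \<times> B \<times> C \<subseteq> - {(x, y, z). cocircular x y z}"
      using AW BC by auto
    obtain a where a: "a > 0" "ball (q s) a \<subseteq> A" using ABC openE by blast
    obtain b where b: "b > 0" "ball (q t) b \<subseteq> B" using ABC openE by blast
    obtain c where c: "c > 0" "ball (q u) c \<subseteq> C" using ABC openE by blast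
    from eventually_at_right_real[OF a(1)] eventually_at_right_real[OF b(1)]
      eventually_at_right_real[OF c(1)]
    show ?thesis
    proof eventually_elim
      case (elim e)
      show ?case
      proof (intro impI allI)
        fix x y z assume "dist x (q s) < e" "dist y (q t) < e" "dist z (q u) < e"
        then have "x \<in> A" "y \<in> B" "z \<in> C"
          using elim a b c by (auto simp: dist_commute subset_iff)
        then show "\<not> cocircular x y z" using ABC(7) by auto
      qed
    qed
  qed auto
  have 2: "\<forall>\<^sub>F e in at_right (0 :: real). \<forall>s\<in>S. \<forall>t\<in>S. s \<noteq> t \<longrightarrow>
      (\<forall>x y. dist x (q s) < e \<longrightarrow> dist y (q t) < e \<longrightarrow> x \<noteq> y)"
    using pair by (simp add: eventually_ball_finite_distrib \<open>finite S\<close>)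
  have 3: "\<forall>\<^sub>F e in at_right (0 :: real). \<forall>s\<in>S. \<forall>t\<in>S. \<forall>u\<in>S. s \<noteq> t \<longrightarrow> t \<noteq> u \<longrightarrow> s \<noteq> u \<longrightarrow>
      (\<forall>x y z. dist x (q s) < e \<longrightarrow> dist y (q t) < e \<longrightarrow> dist z (q u) < e \<longrightarrow> \<not> cocircular x y z)"
    using triple by (simp add: eventually_ball_finite_distrib \<open>finite S\<close>)
  obtain e where e: "0 < e"
     "\<forall>s\<in>S. \<forall>t\<in>S. s \<noteq> t \<longrightarrow> (\<forall>x y. dist x (q s) < e \<longrightarrow> dist y (q t) < e \<longrightarrow> x \<noteq> y)"
     "\<forall>s\<in>S. \<forall>t\<in>S. \<forall>u\<in>S. s \<noteq> t \<longrightarrow> t \<noteq> u \<longrightarrow> s \<noteq> u \<longrightarrow>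
      (\<forall>x y z. dist x (q s) < e \<longrightarrow> dist y (q t) < e \<longrightarrow> dist z (q u) < e \<longrightarrow> \<not> cocircular x y z)"
    using eventually_happens'[OF trivial_limit_at_right_real
        eventually_conj[OF eventually_at_right_less eventually_conj[OF 2 3]]]
    by (elim exE conjE)
  show ?thesis
  proof (intro exI[of _ e] conjI allI impI e(1))
    fix q' assume "\<forall>s\<in>S. dist (q' s) (q s) < e"
    then show "general_position_on S q'"
      unfolding general_position_on_def inj_on_def using e(2,3) by meson
  qed
qed

text \<open>The \<sigma>-ideal generated by the unit circles. It is contained in every ideal that
  the theorem admits, and the set \<open>B\<close> is built from it alone.\<close>

definition circle_small :: "plane set \<Rightarrow> bool" where
  "circle_small A \<longleftrightarrow> (\<exists>C. countable C \<and> A \<subseteq> (\<Union>c\<in>C. sphere c 1))"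

lemma circle_small_UN:
  assumes "countable J" "\<And>j. j \<in> J \<Longrightarrow> circle_small (A j)"
  shows "circle_small (\<Union>j\<in>J. A j)"
proof -
  obtain C where "\<And>j. j \<in> J \<Longrightarrow> countable (C j) \<and> A j \<subseteq> (\<Union>c\<in>C j. sphere c 1)"
    using assms(2) unfolding circle_small_def by metis
  then show ?thesis
    using assms(1) unfolding circle_small_def by (intro exI[of _ "\<Union>j\<in>J. C j"]) fastforce
qed

lemma circle_small_Un:
  assumes "circle_small A" "circle_small B"
  shows "circle_small (A \<union> B)"
proof -
  obtain C D where "countable C" "A \<subseteq> (\<Union>c\<in>C. sphere c 1)"
    "countable D" "B \<subseteq> (\<Union>c\<in>D. sphere c 1)"
    using assms unfolding circle_small_def by blast
  then have "countable (C \<union> D)" "A \<union> B \<subseteq> (\<Union>c\<in>C \<union> D. sphere c 1)"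
    by (auto simp del: mem_sphere)
  then show ?thesis unfolding circle_small_def by blast
qed

lemma circle_small_subset: "circle_small B \<Longrightarrow> A \<subseteq> B \<Longrightarrow> circle_small A"
  unfolding circle_small_def by blast

text \<open>Points are chosen one after another. Two earlier points lie on finitely many unit
  circles, so finitely many circles contain all bad choices of the next point.\<close>

lemma ex_general_position_on:
  assumes "finite S" "\<And>s. s \<in> S \<Longrightarrow> \<not> circle_small (V s)"
  shows "\<exists>q. (\<forall>s\<in>S. q s \<in> V s) \<and> general_position_on S q"
  using assms
proof (induction S)
  case empty
  then show ?case by (auto simp: general_position_on_def)
next
  case (insert a S)
  then obtain q where q: "\<And>s. s \<in> S \<Longrightarrow> q s \<in> V s" and gp: "general_position_on S q" by auto
  have inj: "inj_on q S" using gp by (simp add: general_position_on_def)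
  \<comment> \<open>centres of the circles to avoid; the first set makes the new point distinct from the old ones\<close>
  define C where "C = (\<lambda>s. q s + axis 1 1) ` S \<union>
    (\<Union>s\<in>S. \<Union>t\<in>S - {s}. {c. q s \<in> sphere c 1 \<and> q t \<in> sphere c 1})"
  have "finite C"
    unfolding C_def using inj insert.hyps(1)
    by (intro finite_UnI finite_UN_I finite_imageI finite_unit_circles_through_two_points)
       (auto simp: inj_on_def)
  then have "\<not> V a \<subseteq> (\<Union>c\<in>C. sphere c 1)"
    using insert.prems[of a] countable_finite unfolding circle_small_def by blast
  then obtain v where v: "v \<in> V a" "\<And>c. c \<in> C \<Longrightarrow> v \<notin> sphere c 1" by blast
  have ne: "v \<noteq> q s" if "s \<in> S" for s
  proof
    assume "v = q s"
    then have "v \<in> sphere (q s + axis 1 1) 1" by (simp add: dist_norm norm_axis_1)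
    with v(2)[of "q s + axis 1 1"] that show False by (auto simp: C_def)
  qed
  have nc: "\<not> {v, q s, q t} \<subseteq> sphere c 1" if "s \<in> S" "t \<in> S" "s \<noteq> t" for s t c
    using v(2)[of c] that unfolding C_def by auto
  let ?q = "q(a := v)"
  have "general_position_on (insert a S) ?q"
    unfolding general_position_on_def
  proof (intro conjI ballI impI)
    have "\<forall>s\<in>S. s \<noteq> a" using insert.hyps(2) by auto
    then show "inj_on ?q (insert a S)"
      using inj ne unfolding inj_on_def by (metis fun_upd_apply insert_iff)
  next
    fix s t u assume stu: "s \<in> insert a S" "t \<in> insert a S" "u \<in> insert a S" "s \<noteq> t" "t \<noteq> u" "s \<noteq> u"
    show "\<not> cocircular (?q s) (?q t) (?q u)"
    proof (cases "a \<in> {s, t, u}")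
      case True
      \<comment> \<open>Cocircularity depends only on the set of the three points, so the new one
        may be put first.\<close>
      then obtain s' t' where "s' \<in> S" "t' \<in> S" "s' \<noteq> t'"
        "{?q s, ?q t, ?q u} = {v, q s', q t'}"
      proof -
        consider "s = a" | "t = a" | "u = a" using True by auto
        then show thesis
        proof cases
          case 1 then show thesis using stu that[of t u] by auto
        next
          case 2 then show thesis using stu that[of s u] by auto
        next
          case 3 then show thesis using stu that[of s t] by auto
        qed
      qed
      then show ?thesis using nc unfolding cocircular_def by metis
    next
      case False
      then show ?thesis using stu gp by (auto simp: general_position_on_def)
    qed
  qed
  moreover have "\<forall>s\<in>insert a S. ?q s \<in> V s" using v(1) q by auto
  ultimately show ?case by blast
qed

subsection \<open>A perfect set in general position\<close>

text \<open>One level of the Cantor scheme. Points of \<open>F\<close> are picked whose images are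
  in general position; by stability and continuity of \<open>f\<close>, this persists for any
  selection from small enough closed balls around them.\<close>

lemma general_position_cantor_scheme_step:
  fixes f :: "'x::metric_space \<Rightarrow> plane" and V :: "'i \<Rightarrow> 'x set"
  assumes cont: "continuous_on UNIV f"
    and big: "\<And>U. open U \<Longrightarrow> U \<inter> F \<noteq> {} \<Longrightarrow> \<not> circle_small (f ` (U \<inter> F))"
    and S: "finite S" and V: "\<And>s. s \<in> S \<Longrightarrow> open (V s)" "\<And>s. s \<in> S \<Longrightarrow> V s \<inter> F \<noteq> {}"
    and "\<delta> > 0"
  shows "\<exists>p e. 0 < e \<and> e \<le> \<delta> \<and> (\<forall>s\<in>S. p s \<in> F \<and> cball (p s) e \<subseteq> V s) \<and>
    (\<forall>q. (\<forall>s\<in>S. q s \<in> cball (p s) e) \<longrightarrow> general_position_on S (f \<circ> q))"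
proof -
  have "\<exists>q. (\<forall>s\<in>S. q s \<in> f ` (V s \<inter> F)) \<and> general_position_on S q"
    using S big[OF V] by (rule ex_general_position_on)
  then obtain q where q: "\<forall>s\<in>S. q s \<in> f ` (V s \<inter> F)" and gp: "general_position_on S q"
    by blast
  have "\<forall>s\<in>S. \<exists>x. x \<in> V s \<inter> F \<and> f x = q s"
  proof
    fix s assume "s \<in> S"
    with q have "q s \<in> f ` (V s \<inter> F)" ..
    then show "\<exists>x. x \<in> V s \<inter> F \<and> f x = q s" by (auto simp del: Int_iff)
  qed
  from bchoice[OF this] obtain p where "\<forall>s\<in>S. p s \<in> V s \<inter> F \<and> f (p s) = q s" ..
  then have p: "\<And>s. s \<in> S \<Longrightarrow> p s \<in> V s" "\<And>s. s \<in> S \<Longrightarrow> p s \<in> F"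
    "\<And>s. s \<in> S \<Longrightarrow> f (p s) = q s"
    by simp_all
  obtain \<eta> where "\<eta> > 0" and
    \<eta>: "\<forall>q'. (\<forall>s\<in>S. dist (q' s) (q s) < \<eta>) \<longrightarrow> general_position_on S q'"
    using general_position_on_stable[OF S gp] by (elim exE conjE)
  have "\<exists>d>0. cball (p s) d \<subseteq> V s \<inter> f -` ball (q s) \<eta>" if "s \<in> S" for s
  proof -
    have "open (V s \<inter> f -` ball (q s) \<eta>)"
      using V(1)[OF that] by (intro open_Int open_vimage cont) auto
    moreover have "p s \<in> V s \<inter> f -` ball (q s) \<eta>"
      using p that \<open>\<eta> > 0\<close> by simp
    ultimately show ?thesis by (simp only: open_contains_cball_eq)
  qed
  then have "\<forall>s\<in>S. \<exists>d>0. cball (p s) d \<subseteq> V s \<inter> f -` ball (q s) \<eta>" ..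
  from bchoice[OF this] obtain d where
    "\<forall>s\<in>S. d s > 0 \<and> cball (p s) (d s) \<subseteq> V s \<inter> f -` ball (q s) \<eta>" ..
  then have d: "\<And>s. s \<in> S \<Longrightarrow> d s > 0"
    "\<And>s. s \<in> S \<Longrightarrow> cball (p s) (d s) \<subseteq> V s \<inter> f -` ball (q s) \<eta>"
    by simp_all
  \<comment> \<open>Inserting \<open>\<delta>\<close> bounds the radius and keeps the minimum
    defined when \<open>S\<close> is empty.\<close>
  define e where "e = Min (insert \<delta> (d ` S))"
  have e: "0 < e" "e \<le> \<delta>" "\<And>s. s \<in> S \<Longrightarrow> e \<le> d s"
    using S d(1) \<open>\<delta> > 0\<close> by (auto simp: e_def)
  have sub: "cball (p s) e \<subseteq> V s \<inter> f -` ball (q s) \<eta>" if "s \<in> S" for s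
    using d(2)[OF that] subset_cball[OF e(3)[OF that]] by blast
  show ?thesis
  proof (intro exI[of _ p] exI[of _ e] conjI ballI allI impI e(1,2))
    show "p s \<in> F" "cball (p s) e \<subseteq> V s" if "s \<in> S" for s
      using that p(2) sub by auto
    fix r assume r: "\<forall>s\<in>S. r s \<in> cball (p s) e"
    have "dist ((f \<circ> r) s) (q s) < \<eta>" if "s \<in> S" for s
    proof -
      have "r s \<in> f -` ball (q s) \<eta>" using r sub[OF that] that by blast
      then show ?thesis by (simp add: dist_commute)
    qed
    with \<eta> show "general_position_on S (f \<circ> r)" by blast
  qed
qed

text \<open>The points are limits of the branches of a binary Cantor scheme, one branch for each set
  of naturals. General position concerns at most three branches at once, and these separate at a
  finite level.\<close>

lemma ex_general_position_continuum:
  fixes F :: "'x::complete_space set" and f :: "'x \<Rightarrow> plane"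
  assumes F: "closed F" "F \<noteq> {}" and cont: "continuous_on UNIV f"
    and big: "\<And>U. open U \<Longrightarrow> U \<inter> F \<noteq> {} \<Longrightarrow> \<not> circle_small (f ` (U \<inter> F))"
  obtains g :: "nat set \<Rightarrow> 'x" where "range g \<subseteq> F" "general_position_on UNIV (f \<circ> g)"
proof -
  \<comment> \<open>Words in \<open>L n\<close> label the balls of level \<open>n\<close>. The
    newest bit is at the head, so \<open>tl s\<close> is the parent of \<open>s\<close>.\<close>
  define L where "L n = {s :: bool list. length s = n}" for n
  have finL: "finite (L n)" for n
    using finite_lists_length_eq[of "UNIV :: bool set" n] by (simp add: L_def)
  \<comment> \<open>A state is the family of centres together with one common radius.
    \<open>P\<close> constrains arbitrary selections from the balls, so it will apply to the limit
    points of the branches.\<close>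
  define P where "P n st \<longleftrightarrow> 0 < snd st \<and> snd st \<le> (1/2)^n \<and> (\<forall>s\<in>L n. fst st s \<in> F) \<and>
     (\<forall>q. (\<forall>s\<in>L n. q s \<in> cball (fst st s) (snd st)) \<longrightarrow> general_position_on (L n) (f \<circ> q))"
    for n and st :: "(bool list \<Rightarrow> 'x) \<times> real"
  define Q where "Q n st st' \<longleftrightarrow>
     (\<forall>s\<in>L n. \<forall>b. cball (fst st' (b # s)) (snd st') \<subseteq> cball (fst st s) (snd st))"
    for n and st st' :: "(bool list \<Rightarrow> 'x) \<times> real"
  have "\<exists>\<sigma>. \<forall>n. P n (\<sigma> n) \<and> Q n (\<sigma> n) (\<sigma> (Suc n))"
  proof (rule dependent_nat_choice)
    have "\<exists>p e. 0 < e \<and> e \<le> 1 \<and> (\<forall>s\<in>L 0. p s \<in> F \<and> cball (p s) e \<subseteq> UNIV) \<and>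
      (\<forall>q. (\<forall>s\<in>L 0. q s \<in> cball (p s) e) \<longrightarrow> general_position_on (L 0) (f \<circ> q))"
      using F(2) by (intro general_position_cantor_scheme_step[OF cont big finL]) auto
    then obtain p e where "0 < e" "e \<le> 1" "\<forall>s\<in>L 0. p s \<in> F \<and> cball (p s) e \<subseteq> UNIV"
      "\<forall>q. (\<forall>s\<in>L 0. q s \<in> cball (p s) e) \<longrightarrow> general_position_on (L 0) (f \<circ> q)"
      by (elim exE conjE)
    then have "P 0 (p, e)" by (simp add: P_def)
    then show "\<exists>st. P 0 st" ..
  next
    fix st n assume st: "P n st"
    let ?V = "\<lambda>s. ball (fst st (tl s)) (snd st)"
    have tl: "tl s \<in> L n" if "s \<in> L (Suc n)" for s using that by (auto simp: L_def)
    have "?V s \<inter> F \<noteq> {}" if "s \<in> L (Suc n)" for s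
    proof -
      have "fst st (tl s) \<in> ?V s \<inter> F" using st tl[OF that] by (simp add: P_def)
      then show ?thesis by blast
    qed
    then have "\<exists>p e. 0 < e \<and> e \<le> (1/2)^Suc n \<and> (\<forall>s\<in>L (Suc n). p s \<in> F \<and> cball (p s) e \<subseteq> ?V s) \<and>
      (\<forall>q. (\<forall>s\<in>L (Suc n). q s \<in> cball (p s) e) \<longrightarrow> general_position_on (L (Suc n)) (f \<circ> q))"
      by (intro general_position_cantor_scheme_step[OF cont big finL]) auto
    then obtain p e where pe: "0 < e" "e \<le> (1/2)^Suc n"
      "\<forall>s\<in>L (Suc n). p s \<in> F \<and> cball (p s) e \<subseteq> ?V s"
      "\<forall>q. (\<forall>s\<in>L (Suc n). q s \<in> cball (p s) e) \<longrightarrow> general_position_on (L (Suc n)) (f \<circ> q)"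
      by (elim exE conjE)
    have "P (Suc n) (p, e)" using pe by (simp add: P_def)
    moreover have "Q n st (p, e)"
      unfolding Q_def
    proof (intro ballI allI)
      fix s b assume "s \<in> L n"
      then have "b # s \<in> L (Suc n)" by (simp add: L_def)
      from bspec[OF pe(3) this] have "cball (p (b # s)) e \<subseteq> ball (fst st s) (snd st)" by simp
      also have "\<dots> \<subseteq> cball (fst st s) (snd st)" by (rule ball_subset_cball)
      finally show "cball (fst (p, e) (b # s)) (snd (p, e)) \<subseteq> cball (fst st s) (snd st)" by simp
    qed
    ultimately show "\<exists>st'. P (Suc n) st' \<and> Q n st st'" by blast
  qed
  then obtain \<sigma> where \<sigma>: "\<And>n. P n (\<sigma> n)" "\<And>n. Q n (\<sigma> n) (\<sigma> (Suc n))" by blast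
  define r where "r A n = rev (map (\<lambda>i. i \<in> A) [0..<n])" for A :: "nat set" and n
  have rL: "r A n \<in> L n" for A n by (simp add: r_def L_def)
  have rSuc: "r A (Suc n) = (n \<in> A) # r A n" for A n by (simp add: r_def)
  define C where "C A n = cball (fst (\<sigma> n) (r A n)) (snd (\<sigma> n)) \<inter> F" for A n
  have "\<exists>a. \<forall>n. a \<in> C A n" for A
  proof -
    \<comment> \<open>Cantor's intersection theorem, where completeness enters; the bound
      \<open>(1/2)^n\<close> on the radii makes the diameters tend to zero.\<close>
    have "\<exists>a. \<Inter>(range (C A)) = {a}"
    proof (rule decreasing_closed_nest_sing)
      show "closed (C A n)" for n unfolding C_def using F(1) by (intro closed_Int) auto
      show "C A n \<noteq> {}" for n
      proof -
        have "fst (\<sigma> n) (r A n) \<in> C A n" using \<sigma>(1)[of n] rL[of A n] by (simp add: C_def P_def)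
        then show ?thesis by blast
      qed
      have "C A (Suc n) \<subseteq> C A n" for n
        using \<sigma>(2)[of n] rL[of A n] unfolding C_def rSuc Q_def by blast
      then show "C A n \<subseteq> C A m" if "m \<le> n" for m n
        using that by (rule lift_Suc_antimono_le)
      fix \<epsilon> :: real assume "\<epsilon> > 0"
      then obtain n where n: "(1/2)^n < \<epsilon> / 2"
        using real_arch_pow_inv[of "\<epsilon> / 2" "1/2"] by auto
      have "dist x y < \<epsilon>" if "x \<in> C A n" "y \<in> C A n" for x y
      proof -
        have "dist x y \<le> dist (fst (\<sigma> n) (r A n)) x + dist (fst (\<sigma> n) (r A n)) y"
          by (rule dist_triangle3)
        also have "\<dots> \<le> snd (\<sigma> n) + snd (\<sigma> n)"
          using that by (intro add_mono) (auto simp: C_def)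
        also have "\<dots> < \<epsilon>" using \<sigma>(1)[of n] n by (simp add: P_def)
        finally show ?thesis .
      qed
      then show "\<exists>n. \<forall>x\<in>C A n. \<forall>y\<in>C A n. dist x y < \<epsilon>" by blast
    qed
    then obtain a where "\<Inter>(range (C A)) = {a}" ..
    then have "\<forall>n. a \<in> C A n" by auto
    then show ?thesis ..
  qed
  then have "\<forall>A. \<exists>a. \<forall>n. a \<in> C A n" ..
  from choice[OF this] obtain g where g: "\<And>A n. g A \<in> C A n" by auto
  have gp: "general_position_on T (f \<circ> g)" if "finite T" for T
  proof -
    \<comment> \<open>For distinct \<open>A\<close> and \<open>B\<close>, \<open>k A B\<close> is a
      place where they differ; a level \<open>n\<close> above all these places gives the members of
      \<open>T\<close> distinct nodes.\<close>
    have "\<forall>A B :: nat set. \<exists>k. A \<noteq> B \<longrightarrow> (k \<in> A \<longleftrightarrow> k \<notin> B)" by blast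
    then obtain k where k: "\<And>A B :: nat set. A \<noteq> B \<Longrightarrow> k A B \<in> A \<longleftrightarrow> k A B \<notin> B" by metis
    have "finite (\<Union>A\<in>T. k A ` T)" using that by blast
    then obtain n where n: "\<And>i. i \<in> (\<Union>A\<in>T. k A ` T) \<Longrightarrow> i < n"
      unfolding finite_nat_set_iff_bounded by blast
    have inj: "inj_on (\<lambda>A. r A n) T"
    proof (rule inj_onI, rule ccontr)
      fix A B assume AB: "A \<in> T" "B \<in> T" "r A n = r B n" "A \<noteq> B"
      then have "k A B < n" using n by blast
      then show False using AB(3) k[OF AB(4)] by (simp add: r_def)
    qed
    \<comment> \<open>\<open>P\<close> speaks of selections on the whole level, so nodes off the
      branches in \<open>T\<close> are filled with the centres of their balls.\<close>
    define q where "q s = (if s \<in> (\<lambda>A. r A n) ` T then g (inv_into T (\<lambda>A. r A n) s) else fst (\<sigma> n) s)"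
      for s
    have qg: "q (r A n) = g A" if "A \<in> T" for A
      using that inv_into_f_f[OF inj that] by (simp add: q_def)
    have "q s \<in> cball (fst (\<sigma> n) s) (snd (\<sigma> n))" for s
    proof (cases "s \<in> (\<lambda>A. r A n) ` T")
      case True
      then obtain A where A: "A \<in> T" "s = r A n" by blast
      then show ?thesis using g[of A n] by (simp add: qg C_def)
    next
      case False
      then show ?thesis using \<sigma>(1)[of n] by (simp add: q_def P_def)
    qed
    then have gpq: "general_position_on (L n) (f \<circ> q)"
      using \<sigma>(1)[of n] unfolding P_def by blast
    have *: "(f \<circ> q) (r A n) = (f \<circ> g) A" if "A \<in> T" for A using qg[OF that] by simp
    show ?thesis
      unfolding general_position_on_def
    proof (intro conjI ballI impI)
      show "inj_on (f \<circ> g) T"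
      proof (rule inj_onI)
        fix A B assume AB: "A \<in> T" "B \<in> T" "(f \<circ> g) A = (f \<circ> g) B"
        then have "(f \<circ> q) (r A n) = (f \<circ> q) (r B n)" by (simp only: *)
        then have "r A n = r B n"
          using gpq rL unfolding general_position_on_def by (meson inj_onD)
        then show "A = B" using inj AB by (simp add: inj_on_def)
      qed
    next
      fix A B D assume ABD: "A \<in> T" "B \<in> T" "D \<in> T" "A \<noteq> B" "B \<noteq> D" "A \<noteq> D"
      then have "r A n \<noteq> r B n" "r B n \<noteq> r D n" "r A n \<noteq> r D n"
        using inj by (auto simp: inj_on_def)
      then have "\<not> cocircular ((f \<circ> q) (r A n)) ((f \<circ> q) (r B n)) ((f \<circ> q) (r D n))"
        using gpq rL unfolding general_position_on_def by blast
      then show "\<not> cocircular ((f \<circ> g) A) ((f \<circ> g) B) ((f \<circ> g) D)"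
        unfolding *[OF ABD(1)] *[OF ABD(2)] *[OF ABD(3)] .
    qed
  qed
  have "general_position_on UNIV (f \<circ> g)"
    unfolding general_position_on_def
  proof (intro conjI ballI impI)
    show "inj (f \<circ> g)"
    proof (rule injI)
      fix A B assume AB: "(f \<circ> g) A = (f \<circ> g) B"
      have "general_position_on {A, B} (f \<circ> g)" by (rule gp) simp
      then have "inj_on (f \<circ> g) {A, B}"
        unfolding general_position_on_def by (rule conjunct1)
      from this AB show "A = B" by (rule inj_onD) simp_all
    qed
  next
    fix A B D :: "nat set" assume ABD: "A \<noteq> B" "B \<noteq> D" "A \<noteq> D"
    have "general_position_on {A, B, D} (f \<circ> g)" by (rule gp) simp
    then show "\<not> cocircular ((f \<circ> g) A) ((f \<circ> g) B) ((f \<circ> g) D)"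
      using ABD unfolding general_position_on_def by (simp only: ball_simps insert_iff simp_thms)
  qed
  moreover have "range g \<subseteq> F" using g by (auto simp: C_def)
  ultimately show thesis using that by blast
qed

subsection \<open>Borel sets as projections of closed sets\<close>

text \<open>In Polish spaces these are the classical analytic sets. Real sequences as witnesses,
  rather than integer ones, can store reciprocals of distances directly.\<close>

definition analytic :: "'a::metric_space set \<Rightarrow> bool" where
  "analytic A \<longleftrightarrow> (\<exists>F :: ('a \<times> (nat \<Rightarrow> real)) set. closed F \<and> A = fst ` F)"

lemma analytic_closed: "closed A \<Longrightarrow> analytic A"
  unfolding analytic_def
  by (intro exI[of _ "A \<times> UNIV"]) (auto simp: closed_Times)

lemma analytic_open:
  assumes "open A"
  shows "analytic A"
\<comment> \<open>\<open>infdist\<close> to the empty set is 0 by convention, so the whole space is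
  treated separately.\<close>
proof (cases "A = UNIV")
  case True
  then show ?thesis by (simp add: analytic_closed)
next
  case False
  \<comment> \<open>a point lies in \<open>A\<close> iff its distance to the complement can be scaled up to 1\<close>
  let ?F = "{p :: 'a \<times> (nat \<Rightarrow> real). 1 \<le> snd p 0 * infdist (fst p) (- A)}"
  have "closed ?F"
    by (intro closed_Collect_le continuous_intros continuous_on_infdist
        continuous_on_product_then_coordinatewise)
  moreover have "x \<in> fst ` ?F \<longleftrightarrow> x \<in> A" for x
  proof
    assume "x \<in> fst ` ?F"
    then have "infdist x (- A) \<noteq> 0" by auto
    then show "x \<in> A" by (metis ComplI infdist_zero)
  next
    assume "x \<in> A"
    then have "infdist x (- A) > 0"
      using False assms by (intro infdist_pos_not_in_closed) auto
    then have "(x, \<lambda>_. 1 / infdist x (- A)) \<in> ?F" by simp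
    then show "x \<in> fst ` ?F" by (rule rev_image_eqI) simp
  qed
  ultimately show ?thesis unfolding analytic_def by blast
qed

lemma analytic_UN:
  assumes "\<And>k :: nat. analytic (A k)"
  shows "analytic (\<Union>k. A k)"
proof -
  obtain F :: "nat \<Rightarrow> ('a \<times> (nat \<Rightarrow> real)) set" where
    F: "\<And>k. closed (F k)" "\<And>k. A k = fst ` F k"
    using assms unfolding analytic_def by metis
  \<comment> \<open>coordinate 0 codes the index \<open>k\<close>, the remaining ones a witness for \<open>A k\<close>\<close>
  define G where "G = (\<lambda>p :: 'a \<times> (nat \<Rightarrow> real). snd p 0) -` \<nat> \<inter>
    (\<Inter>k. {p. 1 \<le> \<bar>snd p 0 - real k\<bar>} \<union> (\<lambda>p. (fst p, \<lambda>i. snd p (Suc i))) -` F k)"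
  \<comment> \<open>For a natural number, distance at least 1 from \<open>k\<close> means differing
    from \<open>k\<close>; this makes the case distinction in \<open>G\<close> a closed
    condition.\<close>
  have "closed G"
    unfolding G_def
    by (intro closed_Int closed_INT ballI closed_Un closed_Collect_le closed_vimage F closed_Nats
        continuous_intros continuous_on_product_then_coordinatewise)
  moreover have "x \<in> fst ` G \<longleftrightarrow> x \<in> (\<Union>k. A k)" for x
  proof
    assume "x \<in> fst ` G"
    then obtain s where s: "(x, s) \<in> G" by auto
    then obtain k where "s 0 = real k" by (auto simp: G_def Nats_def)
    with s have "(x, \<lambda>i. s (Suc i)) \<in> F k" by (auto simp: G_def dest: spec[of _ k])
    then show "x \<in> (\<Union>k. A k)" using F(2)[of k] by force
  next
    assume "x \<in> (\<Union>k. A k)"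
    then obtain k s where s: "(x, s) \<in> F k" using F(2) by auto
    have "1 \<le> \<bar>real k - real j\<bar> \<or> (x, s) \<in> F j" for j
      using s by (cases "j = k") auto
    then have "(x, case_nat (real k) s) \<in> G" by (simp add: G_def)
    then show "x \<in> fst ` G" by (rule rev_image_eqI) simp
  qed
  ultimately show ?thesis unfolding analytic_def by blast
qed

text \<open>A single sequence stores witnesses for all \<open>k\<close>, the one for
  \<open>k\<close> sitting at the places \<open>prod_encode (k, i)\<close>.\<close>

lemma analytic_INT:
  assumes "\<And>k :: nat. analytic (A k)"
  shows "analytic (\<Inter>k. A k)"
proof -
  obtain F :: "nat \<Rightarrow> ('a \<times> (nat \<Rightarrow> real)) set" where
    F: "\<And>k. closed (F k)" "\<And>k. A k = fst ` F k"
    using assms unfolding analytic_def by metis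
  define G where "G = (\<Inter>k. (\<lambda>p. (fst p, \<lambda>i. snd p (prod_encode (k, i)))) -` F k)"
  have "closed G"
    unfolding G_def
    by (intro closed_INT ballI closed_vimage F
        continuous_intros continuous_on_product_then_coordinatewise)
  moreover have "x \<in> fst ` G \<longleftrightarrow> x \<in> (\<Inter>k. A k)" for x
  proof
    assume "x \<in> fst ` G"
    then show "x \<in> (\<Inter>k. A k)" using F(2) by (force simp: G_def)
  next
    assume "x \<in> (\<Inter>k. A k)"
    then have "\<forall>k. x \<in> fst ` F k" using F(2) by blast
    then have "\<forall>k. \<exists>s. (x, s) \<in> F k" by (simp add: image_iff Bex_def)
    from choice[OF this] obtain s where s: "\<forall>k. (x, s k) \<in> F k" ..
    have "(x, \<lambda>j. case prod_decode j of (k, i) \<Rightarrow> s k i) \<in> G" using s by (simp add: G_def)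
    then show "x \<in> fst ` G" by (rule rev_image_eqI) simp
  qed
  ultimately show ?thesis unfolding analytic_def by blast
qed

text \<open>Analytic sets are in general not closed under complements, so the induction over the
  \<sigma>-algebra carries each set together with its complement.\<close>

lemma borel_imp_analytic:
  fixes A :: "'a::metric_space set"
  assumes "A \<in> sets borel"
  shows "analytic A"
proof -
  have "A \<in> sigma_sets UNIV {S. open S}"
    using assms by (simp add: borel_def)
  then have "analytic A \<and> analytic (- A)"
  proof induction
    case (Basic a)
    then show ?case by (simp add: analytic_open analytic_closed closed_Compl)
  next
    case Empty
    show ?case by (simp add: analytic_closed)
  next
    case (Compl a)
    then show ?case by (simp add: Compl_eq_Diff_UNIV[symmetric])
  next
    case (Union a)
    then show ?case by (auto intro: analytic_UN analytic_INT)
  qed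
  then show ?thesis ..
qed

text \<open>A Borel set is the projection of a closed set, and a closed set is coded by the indices
  of basic open sets making up its complement.\<close>

lemma borel_enumerated_by_nat_set:
  obtains D :: "nat set \<Rightarrow> 'a::{metric_space, second_countable_topology} set"
  where "sets borel \<subseteq> range D"
proof -
  obtain B :: "('a \<times> (nat \<Rightarrow> real)) set set" where B: "countable B" "topological_basis B"
    using ex_countable_basis by blast
  define D where "D S = fst ` (- \<Union>(from_nat_into B ` S))" for S
  have "A \<in> range D" if "A \<in> sets borel" for A
  proof -
    obtain F :: "('a \<times> (nat \<Rightarrow> real)) set" where F: "closed F" "A = fst ` F"
      using borel_imp_analytic[OF \<open>A \<in> sets borel\<close>] unfolding analytic_def by blast
    have "open (- F)" using F(1) by (rule open_Compl)
    with B(2) have "\<exists>B'\<subseteq>B. \<Union>B' = - F" by (simp add: topological_basis_def)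
    then obtain B' where B': "B' \<subseteq> B" "\<Union>B' = - F" by blast
    have "from_nat_into B (to_nat_on B b) = b" if "b \<in> B'" for b
      using B(1) B'(1) that by (intro from_nat_into_to_nat_on) auto
    then have "from_nat_into B ` to_nat_on B ` B' = B'"
      unfolding image_image by simp
    then have "D (to_nat_on B ` B') = A" using B' F(2) by (simp add: D_def)
    then show ?thesis by blast
  qed
  then show thesis using that by blast
qed

text \<open>As for the perfect kernel in the Cantor-Bendixson theorem, all basic open parts of
  \<open>F\<close> with small projection are discarded. They are countably many, so the rest is
  nonempty, and none of its nonempty relatively open parts has a small projection.\<close>

lemma analytic_general_position_continuum:
  assumes "analytic A" "\<not> circle_small A"
  obtains g :: "nat set \<Rightarrow> plane" where "range g \<subseteq> A" "general_position_on UNIV g"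
proof -
  obtain F :: "(plane \<times> (nat \<Rightarrow> real)) set" where F: "closed F" "A = fst ` F"
    using assms(1) unfolding analytic_def by blast
  obtain B :: "(plane \<times> (nat \<Rightarrow> real)) set set" where B: "countable B" "topological_basis B"
    using ex_countable_basis by blast
  define W where "W = {b \<in> B. circle_small (fst ` (b \<inter> F))}"
  have W: "countable W" "open (\<Union>W)"
    using B by (auto simp: W_def topological_basis_open)
  have small: "circle_small (\<Union>b\<in>W. fst ` (b \<inter> F))"
    using W(1) by (rule circle_small_UN) (simp add: W_def)
  let ?K = "F - \<Union>W"
  obtain g :: "nat set \<Rightarrow> plane \<times> (nat \<Rightarrow> real)" where
    g: "range g \<subseteq> ?K" "general_position_on UNIV (fst \<circ> g)"
  proof (rule ex_general_position_continuum[of ?K fst])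
    show "closed ?K" using F(1) W(2) by (rule closed_Diff)
    show "?K \<noteq> {}"
    proof
      assume "?K = {}"
      then have "A \<subseteq> (\<Union>b\<in>W. fst ` (b \<inter> F))" using F(2) by blast
      with assms(2) small show False using circle_small_subset by blast
    qed
    show "continuous_on UNIV (fst :: plane \<times> (nat \<Rightarrow> real) \<Rightarrow> plane)"
      by (intro continuous_intros)
    show "\<not> circle_small (fst ` (U \<inter> ?K))" if U_open: "open U" and U_meets: "U \<inter> ?K \<noteq> {}" for U
    proof
      assume U: "circle_small (fst ` (U \<inter> ?K))"
      obtain x where x: "x \<in> U" "x \<in> ?K" using U_meets by blast
      obtain b where b: "b \<in> B" "x \<in> b" "b \<subseteq> U"
        using topological_basisE[OF B(2) U_open x(1)] by blast
      \<comment> \<open>What \<open>b\<close> loses in passing from \<open>F\<close> to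
        \<open>?K\<close> projects to a small set, so \<open>b\<close> itself would have been
        discarded.\<close>
      have "fst ` (b \<inter> F) \<subseteq> fst ` (U \<inter> ?K) \<union> (\<Union>b\<in>W. fst ` (b \<inter> F))"
        using b by blast
      then have "circle_small (fst ` (b \<inter> F))"
        using circle_small_Un[OF U small] circle_small_subset by blast
      then have "b \<in> W" using b by (simp add: W_def)
      with x b show False by blast
    qed
  qed
  show thesis
    by (rule that[of "fst \<circ> g"]) (use g F(2) in auto)
qed

subsection \<open>Avoiding distance one\<close>

text \<open>Each unit circle passes through only finitely many of the points, so fewer than
  continuum many circles cannot exhaust continuum many points.\<close>

lemma ex_point_off_few_circles:
  includes cardinal_syntax
  fixes g :: "nat set \<Rightarrow> plane" and x :: "'i \<Rightarrow> plane"
  assumes gp: "general_position_on UNIV g" and J: "|J| <o |UNIV :: nat set set|"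
  shows "\<exists>p\<in>range g. \<forall>j\<in>J. dist p (x j) \<noteq> 1"
proof (rule ccontr)
  assume "\<not> ?thesis"
  then have cover: "(UNIV :: nat set set) \<subseteq> (\<Union>j\<in>J. {s \<in> UNIV. g s \<in> sphere (x j) 1})"
    by (auto simp: dist_commute)
  have fin: "finite {s \<in> UNIV. g s \<in> sphere (x j) 1}" for j
    using gp by (rule finite_general_position_on_sphere)
  have inf: "infinite (UNIV :: nat set set)"
    by (simp add: Finite_Set.finite_set)
  show False
  proof (cases "finite J")
    case True
    then have "finite (\<Union>j\<in>J. {s \<in> UNIV. g s \<in> sphere (x j) 1})" using fin by blast
    with cover inf show False using finite_subset by blast
  next
    case False
    have "|{s \<in> UNIV. g s \<in> sphere (x j) 1}| \<le>o |J|" for j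
      by (intro ordLess_imp_ordLeq finite_ordLess_infinite card_of_Well_order)
        (simp_all only: Field_card_of fin False not_False_eq_True)
    \<comment> \<open>For infinite \<open>J\<close>, a union of finite sets indexed by
      \<open>J\<close> has cardinality at most \<open>|J|\<close>.\<close>
    with False have "|\<Union>j\<in>J. {s \<in> UNIV. g s \<in> sphere (x j) 1}| \<le>o |J|"
      by (intro card_of_UNION_ordLeq_infinite ballI ordLeq_refl card_of_Card_order) simp_all
    moreover have "|UNIV :: nat set set| \<le>o |\<Union>j\<in>J. {s \<in> UNIV. g s \<in> sphere (x j) 1}|"
      using cover by (rule card_of_mono1)
    ultimately have "|UNIV :: nat set set| \<le>o |J|"
      using ordLeq_transitive by blast
    with J show False using not_ordLess_ordLeq by blast
  qed
qed

text \<open>Codes of Borel sets are handled along a well-order of minimal length, so that at each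
  stage fewer than continuum many points have been placed and
  \<open>ex_point_off_few_circles\<close> applies.\<close>

lemma ex_unit_distance_free_set:
  includes cardinal_syntax
  obtains B :: "plane set" where "\<And>x y. x \<in> B \<Longrightarrow> y \<in> B \<Longrightarrow> dist x y \<noteq> 1"
    "\<And>A. A \<in> sets borel \<Longrightarrow> \<not> circle_small A \<Longrightarrow> A \<inter> B \<noteq> {}"
proof -
  obtain D :: "nat set \<Rightarrow> plane set" where D: "sets borel \<subseteq> range D"
    by (rule borel_enumerated_by_nat_set)
  \<comment> \<open>\<open>D\<close> may take values that are not Borel; \<open>E\<close> keeps the
    codes of the sets that \<open>B\<close> has to meet.\<close>
  define E where "E = {i. D i \<in> sets borel \<and> \<not> circle_small (D i)}"
  let ?r = "|UNIV :: nat set set|"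
  have wo: "Well_order ?r" by (rule card_of_Well_order)
  have wf: "wf (?r - Id)" using wo by (simp add: well_order_on_def)
  have lin: "Linear_order ?r" using wo by (simp add: well_order_on_def)
  define P where "P x i p \<longleftrightarrow> i \<in> E \<longrightarrow>
      p \<in> D i \<and> (\<forall>j. (j, i) \<in> ?r - Id \<longrightarrow> dist p (x j) \<noteq> 1)" for x :: "nat set \<Rightarrow> plane" and i p
  have "\<exists>x. \<forall>i. P x i (x i)"
  proof (rule dependent_wf_choice[OF wf])
    \<comment> \<open>Well-founded recursion requires that the demand at \<open>i\<close> depend on
      earlier values only.\<close>
    show "P x i p = P y i p" if "\<And>j. (j, i) \<in> ?r - Id \<Longrightarrow> x j = y j" for x y i p
      unfolding P_def using that by metis
    show "\<exists>p. P x i p" for x i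
    proof (cases "i \<in> E")
      case True
      then have "analytic (D i)" "\<not> circle_small (D i)"
        by (simp_all add: E_def borel_imp_analytic)
      then obtain g :: "nat set \<Rightarrow> plane" where g: "range g \<subseteq> D i" "general_position_on UNIV g"
        by (rule analytic_general_position_continuum)
      have "|underS ?r i| <o ?r"
        by (rule card_of_underS[OF card_of_Card_order]) (simp add: Field_card_of)
      from ex_point_off_few_circles[OF g(2) this, of x]
      obtain p where "p \<in> range g" "\<forall>j\<in>underS ?r i. dist p (x j) \<noteq> 1" ..
      with g(1) have "P x i p" by (auto simp: P_def underS_def)
      then show ?thesis ..
    qed (simp add: P_def)
  qed
  then obtain x where x: "\<forall>i. P x i (x i)" ..
  have off: "dist (x i) (x j) \<noteq> 1" if "i \<in> E" "j \<in> E" for i j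
  proof (cases "i = j")
    case False
    \<comment> \<open>Of two indices, the later one received a point avoiding distance 1 from the
      point of the earlier one.\<close>
    then have "(i, j) \<in> ?r - Id \<or> (j, i) \<in> ?r - Id"
      using lin by (auto simp: linear_order_on_def total_on_def Field_card_of)
    then show ?thesis
      using x that unfolding P_def by (metis dist_commute)
  qed simp
  show thesis
  proof (rule that[of "x ` E"])
    show "dist a b \<noteq> 1" if "a \<in> x ` E" "b \<in> x ` E" for a b
      using that off by auto
    show "A \<inter> x ` E \<noteq> {}" if A: "A \<in> sets borel" "\<not> circle_small A" for A
    proof -
      obtain i where i: "A = D i" using A(1) D by blast
      with A have "i \<in> E" by (simp add: E_def)
      then have "x i \<in> D i" using x by (simp add: P_def)
      with i \<open>i \<in> E\<close> show ?thesis by blast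
    qed
  qed
qed

section \<open>Complete nonmeasurability of a set without unit distances\<close>

theorem mainTheorem18:
  fixes I :: "plane set set"
  assumes "sigma_ideal I"
    and "proper_ideal I"
    and "translation_invariant I"
    and "\<And>x. {x} \<in> I"
    and "has_borel_base I"
    and "\<And>x. sphere x 1 \<in> I"
  shows "\<exists>B :: plane set. completely_nonmeasurable I B \<and> \<not> two_I_covering B"
proof -
  have sub: "B \<in> I" if "A \<in> I" "B \<subseteq> A" for A B
    using assms(1) that unfolding sigma_ideal_def by blast
  have UN: "(\<Union>n. F n) \<in> I" if "\<And>n. F n \<in> I" for F :: "nat \<Rightarrow> plane set"
    using assms(1) that unfolding sigma_ideal_def by blast
  have Un: "A \<union> B \<in> I" if "A \<in> I" "B \<in> I" for A B
  proof -
    have "(\<Union>n :: nat. if n = 0 then A else B) \<in> I" using that by (intro UN) simp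
    then show ?thesis by (rule sub) (auto split: if_splits intro: exI[of _ 1])
  qed
  \<comment> \<open>Hence every Borel set outside the ideal is among the sets that \<open>B\<close>
    meets.\<close>
  have small: "A \<in> I" if "circle_small A" for A
  proof -
    from that obtain C where C: "countable C" "A \<subseteq> (\<Union>c\<in>C. sphere c 1)"
      unfolding circle_small_def by (elim exE conjE)
    show ?thesis
    proof (cases "C = {}")
      case True
      with C assms(1) show ?thesis by (simp add: sigma_ideal_def)
    next
      case False
      have "(\<Union>n. sphere (from_nat_into C n) 1) \<in> I" by (intro UN assms(6))
      also have "(\<Union>n. sphere (from_nat_into C n) 1) = (\<Union>c\<in>range (from_nat_into C). sphere c 1)"
        by (simp only: image_image)
      finally show ?thesis
        using C(2) unfolding range_from_nat_into[OF False C(1)] by (rule sub)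
    qed
  qed
  obtain B where B: "\<And>x y. x \<in> B \<Longrightarrow> y \<in> B \<Longrightarrow> dist x y \<noteq> 1"
    "\<And>A. A \<in> sets borel \<Longrightarrow> \<not> circle_small A \<Longrightarrow> A \<inter> B \<noteq> {}"
    using ex_unit_distance_free_set by blast
  have pos: "A \<inter> B \<notin> I" if A: "A \<in> sets borel" "A \<notin> I" for A
  proof
    assume "A \<inter> B \<in> I"
    \<comment> \<open>The Borel base encloses \<open>A \<inter> B\<close> in a Borel set
      \<open>G\<close> of the ideal, so that \<open>A - G\<close> is Borel, still positive, and yet
      disjoint from \<open>B\<close>.\<close>
    then obtain G where G: "G \<in> sets borel" "A \<inter> B \<subseteq> G" "G \<in> I"
      using assms(5) unfolding has_borel_base_def by blast
    have "A - G \<notin> I" using Un[of "A - G" G] sub[of "A - G \<union> G" A] G(3) A(2) by blast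
    then have "(A - G) \<inter> B \<noteq> {}" using A(1) G(1) small by (intro B(2)) auto
    with G(2) show False by blast
  qed
  have neg: "A - B \<notin> I" if A: "A \<in> sets borel" "A \<notin> I" for A
  proof
    assume "A - B \<in> I"
    then obtain G where G: "G \<in> sets borel" "A - B \<subseteq> G" "G \<in> I"
      using assms(5) unfolding has_borel_base_def by blast
    let ?e = "axis 1 1 :: plane"
    \<comment> \<open>\<open>H\<close> is a positive Borel subset of \<open>B\<close>, so its unit translate misses \<open>B\<close>\<close>
    define H where "H = A - G"
    have H: "H \<in> sets borel" "H \<subseteq> B" "H \<notin> I"
      using Un[of "A - G" G] sub[of "A - G \<union> G" A] G A by (auto simp: H_def)
    have "(\<lambda>y. ?e + y) ` H = (\<lambda>y. y - ?e) -` H" by (force simp: image_iff)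
    moreover have "(\<lambda>y. y - ?e) -` H \<in> sets borel"
      using measurable_sets[of "\<lambda>y. y - ?e" borel borel H] H(1) by simp
    ultimately have bor: "(\<lambda>y. ?e + y) ` H \<in> sets borel" by simp
    have "(\<lambda>y. ?e + y) ` H \<notin> I"
    proof
      assume "(\<lambda>y. ?e + y) ` H \<in> I"
      \<comment> \<open>Translating back by \<open>- ?e\<close> recovers \<open>H\<close>, so
        invariance would put \<open>H\<close> into the ideal.\<close>
      then have "(\<lambda>y. - ?e + y) ` (\<lambda>y. ?e + y) ` H \<in> I"
        using assms(3) unfolding translation_invariant_def by blast
      with H(3) show False by (simp add: image_image)
    qed
    then have "(\<lambda>y. ?e + y) ` H \<inter> B \<noteq> {}" using bor small by (intro B(2)) auto
    then obtain y where y: "y \<in> H" "?e + y \<in> B" by blast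
    then have "dist (?e + y) y \<noteq> 1" using H(2) by (intro B(1)) auto
    then show False by (simp add: dist_norm norm_axis_1)
  qed
  have "\<not> two_I_covering B"
  proof
    assume cov: "two_I_covering B"
    \<comment> \<open>The pair \<open>0\<close>, \<open>?e\<close> has distance 1, so
      \<open>B\<close> contains no isometric copy of it.\<close>
    let ?e = "axis 1 1 :: plane"
    have "?e \<noteq> 0" by (metis norm_axis_1 norm_zero zero_neq_one)
    then have "card {0, ?e} = 2" by simp
    then obtain \<phi> where "plane_isometry \<phi>" "\<phi> ` {0, ?e} \<subseteq> B"
      using cov unfolding two_I_covering_def by blast
    then have "dist (\<phi> ?e) (\<phi> 0) = dist ?e 0" and "\<phi> ?e \<in> B" "\<phi> 0 \<in> B"
      by (auto simp: plane_isometry_def)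
    then show False using B(1)[of "\<phi> ?e" "\<phi> 0"] by (simp add: norm_axis_1)
  qed
  with pos neg show ?thesis unfolding completely_nonmeasurable_def by blast
qed

end
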